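(* Let $X$ be an infinite dimensional real Banach space, let $d>0$, and let $(x_n)_{n\in\mathbb{N}}$ be a sequence in $X$ that is normalized ($\|x_n\|=1$ for all $n$), weakly null, and $d$-separated ($\|x_n-x_m\|\ge d$ for all $n\ne m$). Then $K_a(X)\ge d$.
   Context: For a Banach space $X$, $B_X$ denotes its closed unit ball and $X^*$ its dual. For positive constants $c_1,c_2,\delta$, a subset $S$ of a normed space $X$ is called a $(c_1,c_2,\delta)$-b.s.a. (bounded and separated antipodal) subset of $X$ if (1) $\|x\|\le c_1$ for all $x\in S$, and (2) for every $x,y\in S$ with $x\ne y$ there exists $f\in X^*$ with $\|f\|\le c_2$ such that $\delta\le f(y)-f(x)$ and $f(x)\le f(z)\le f(y)$ for all $z\in S$. For an infinite dimensional Banach space $X$, $$K_a(X)=\sup\{\delta>0:\ \text{there exists an infinite } S\subseteq B_X \text{ which is a } (1,1,\delta)\text{-b.s.a. subset of } X\}.$$ *)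

theory Defs
  imports "HOL-Analysis.Bounded_Linear_Function"
begin

text \<open>The dual space \<open>X\<^sup>*\<close> is the type \<^typ>\<open>'a \<Rightarrow>\<^sub>L real\<close> of bounded linear functionals, whose norm is
  the operator norm.\<close>

definition infinite_dimensional :: "'a::real_vector itself \<Rightarrow> bool" where
  "infinite_dimensional TYPE('a) \<longleftrightarrow> \<not> (\<exists>B::'a set. finite B \<and> span B = UNIV)"

definition weakly_null :: "(nat \<Rightarrow> 'a::real_normed_vector) \<Rightarrow> bool" where
  "weakly_null x \<longleftrightarrow>
    (\<forall>f :: 'a \<Rightarrow>\<^sub>L real. (\<lambda>n. blinfun_apply f (x n)) \<longlonglongrightarrow> 0)"

text \<open>Bounded and separated antipodal sets; the parameters are meant to be positive.\<close>

definition bsa :: "real \<Rightarrow> real \<Rightarrow> real \<Rightarrow> 'a::real_normed_vector set \<Rightarrow> bool" where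
  "bsa c1 c2 \<delta> S \<longleftrightarrow>
    (\<forall>x\<in>S. norm x \<le> c1) \<and>
    (\<forall>x\<in>S. \<forall>y\<in>S. x \<noteq> y \<longrightarrow>
      (\<exists>f :: 'a \<Rightarrow>\<^sub>L real. norm f \<le> c2 \<and>
         \<delta> \<le> blinfun_apply f y - blinfun_apply f x \<and>
         (\<forall>z\<in>S. blinfun_apply f x \<le> blinfun_apply f z \<and>
                blinfun_apply f z \<le> blinfun_apply f y)))"

text \<open>The set below is bounded above by 2, because \<open>f y - f x \<le> 2\<close> when \<open>f\<close> has norm at most 1, on the unit
  ball. For an infinite dimensional Banach space it is also nonempty (take a normalized basic
  sequence and normalized differences of its biorthogonal functionals), so the real-valued supremum
  is the genuine one.\<close>

definition K_a :: "'a::banach itself \<Rightarrow> real" where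
  "K_a TYPE('a) =
    Sup {\<delta>. \<delta> > 0 \<and> (\<exists>S::'a set. infinite S \<and> S \<subseteq> cball 0 1 \<and> bsa 1 1 \<delta> S)}"

end

theory Submission
  imports Defs "HOL-Analysis.Convex" "HOL-Library.Ramsey"
begin

text \<open>
  Fix \<open>\<delta> < d\<close> and a small \<open>\<eta> > 0\<close>. The antipodal set is an infinite subsequence of \<open>x\<close> itself. For
  \<open>i < j\<close> let \<open>h\<^sub>i\<^sub>j\<close> be a functional in the dual unit ball. The main point is that along a suitable
  subsequence every \<open>h\<^sub>i\<^sub>j\<close> is smaller than \<open>\<eta>\<close> in absolute value at all terms other than \<open>x\<^sub>i\<close> and \<open>x\<^sub>j\<close>
  (\<open>weakly_null_thinning\<close>). Ramsey's theorem for triples makes the question "is \<open>h\<^sub>i\<^sub>j (x\<^sub>k) \<ge> \<eta>\<close>?"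
  uniform for each relative position of \<open>i\<close>, \<open>j\<close>, \<open>k\<close>, and the answer cannot be yes
  throughout: that would give functionals in the dual ball which are at least \<open>\<eta>\<close> on arbitrarily
  long pieces of an infinite subsequence, hence, by weak-star compactness, one functional which is at
  least \<open>\<eta>\<close> on all of it, contrary to weak nullity. The same applies to \<open>- h\<^sub>i\<^sub>j\<close>.

  It remains to choose \<open>h\<^sub>i\<^sub>j\<close> with \<open>h\<^sub>i\<^sub>j (x\<^sub>j) - h\<^sub>i\<^sub>j (x\<^sub>i) \<ge> d - \<eta>\<close> and with the two values
  essentially on different sides of \<open>0\<close>. If \<open>d > 1\<close>, a norming functional of \<open>x\<^sub>j - x\<^sub>i\<close> will do: its
  two values lie in \<open>[-1, 1]\<close> and differ by more than \<open>1\<close>. If \<open>d \<le> 1\<close>, a norming functional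
  \<open>g\<^sub>j\<close> of \<open>x\<^sub>j\<close> is enough, since after thinning it nearly vanishes at \<open>x\<^sub>i\<close>. Finally, adding
  \<open>3\<eta> (g\<^sub>j - g\<^sub>i)\<close> pushes the two extreme values beyond the errors at the other terms, at the
  price of a factor \<open>1 + 6\<eta>\<close> in the norm (\<open>antipodal_subsequence\<close>).

  Norming functionals and the compactness argument both come from one Hahn--Banach type theorem, the
  one of Mazur and Orlicz (\<open>Mazur_Orlicz\<close>).
\<close>

section \<open>The Mazur--Orlicz theorem\<close>

definition sublinear :: "('a::real_vector \<Rightarrow> real) \<Rightarrow> bool" where
  "sublinear p \<longleftrightarrow> (\<forall>u v. p (u + v) \<le> p u + p v) \<and> (\<forall>t\<ge>0. \<forall>v. p (t *\<^sub>R v) = t * p v)"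

lemma sublinear_add: "sublinear p \<Longrightarrow> p (u + v) \<le> p u + p v"
  and sublinear_scaleR: "sublinear p \<Longrightarrow> 0 \<le> t \<Longrightarrow> p (t *\<^sub>R v) = t * p v"
  by (auto simp: sublinear_def)

lemma sublinear_zero: "sublinear p \<Longrightarrow> p 0 = 0"
  using sublinear_scaleR[of p 0 0] by simp

lemma sublinear_ge_minus: "sublinear p \<Longrightarrow> - p (- v) \<le> p v"
  using sublinear_add[of p v "- v"] sublinear_zero[of p] by simp

lemma sublinearI:
  assumes add: "\<And>u v. p (u + v) \<le> p u + p v"
    and zero: "p 0 = 0"
    and scale: "\<And>t v. 0 < t \<Longrightarrow> p (t *\<^sub>R v) \<le> t * p v"
  shows "sublinear p"
proof -
  have "p (t *\<^sub>R v) = t * p v" if t: "0 < t" for t v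
  proof (rule antisym[OF scale[OF t]])
    have "p (inverse t *\<^sub>R (t *\<^sub>R v)) \<le> inverse t * p (t *\<^sub>R v)"
      using t by (intro scale) simp
    then show "t * p v \<le> p (t *\<^sub>R v)"
      using t by (simp add: field_simps)
  qed
  then show ?thesis
    unfolding sublinear_def using add zero by (metis less_eq_real_def mult_zero_left scaleR_zero_left)
qed

text \<open>
  The infimal convolution of \<open>p\<close> with the constraints in \<open>K\<close>. It is finite because
  \<open>c \<le> p k \<le> p (v + k) + p (- v)\<close> for all \<open>(k, c)\<close> in \<open>K\<close>. The lemma is used twice: to impose the
  constraints, and, with \<open>K\<close> a single ray, to see that minimal sublinear functionals are linear.
\<close>

lemma sublinear_improve:
  fixes p :: "'a::real_vector \<Rightarrow> real"
  assumes p: "sublinear p" and K: "convex_cone K"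
    and Kp: "\<And>v c. (v, c) \<in> K \<Longrightarrow> c \<le> p v"
  obtains q where "sublinear q" "\<And>v. q v \<le> p v" "\<And>v c. (v, c) \<in> K \<Longrightarrow> q (- v) \<le> - c"
proof -
  define q where "q v = (INF z\<in>K. p (v + fst z) - snd z)" for v
  have ne: "K \<noteq> {}" using K by (rule convex_cone_nonempty)
  have zK: "(0, 0) \<in> K" using convex_cone_contains_0[OF K] by (simp add: zero_prod_def)
  have lb: "- p (- v) \<le> p (v + fst z) - snd z" if "z \<in> K" for v z
    using Kp[of "fst z" "snd z"] sublinear_add[OF p, of "v + fst z" "- v"] that by simp
  have bdd: "bdd_below ((\<lambda>z. p (v + fst z) - snd z) ` K)" for v
    using lb by (intro bdd_belowI2)
  have q_le: "q v \<le> p (v + k) - c" if "(k, c) \<in> K" for v k c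
    using cINF_lower[OF bdd that, of v] by (simp add: q_def)
  have q_ge: "b \<le> q v" if "\<And>k c. (k, c) \<in> K \<Longrightarrow> b \<le> p (v + k) - c" for b v
    unfolding q_def using that by (intro cINF_greatest[OF ne]) auto
  show thesis
  proof
    show "q v \<le> p v" for v
      using q_le[OF zK, of v] by simp
    show "q (- v) \<le> - c" if "(v, c) \<in> K" for v c
      using q_le[OF that, of "- v"] sublinear_zero[OF p] by simp
    show "sublinear q"
    proof (rule sublinearI)
      fix u v :: 'a
      have sum: "q (u + v) \<le> (p (u + k) - c) + (p (v + l) - e)"
        if "(k, c) \<in> K" "(l, e) \<in> K" for k c l e
      proof -
        have "(k + l, c + e) \<in> K"
          using convex_cone_add[OF K that] by simp
        from q_le[OF this, of "u + v"] show ?thesis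
          using sublinear_add[OF p, of "u + k" "v + l"] by (simp add: algebra_simps)
      qed
      have "q (u + v) - (p (u + k) - c) \<le> q v" if "(k, c) \<in> K" for k c
        by (rule q_ge) (use sum[OF that] in \<open>simp add: diff_le_eq add.commute\<close>)
      then have "q (u + v) - q v \<le> p (u + k) - c" if "(k, c) \<in> K" for k c
        using that by fastforce
      then have "q (u + v) - q v \<le> q u"
        by (rule q_ge)
      then show "q (u + v) \<le> q u + q v" by simp
    next
      show "q 0 = 0"
        using q_le[OF zK, of 0] q_ge[of 0 0] Kp sublinear_zero[OF p] by fastforce
    next
      fix t :: real and v :: 'a
      assume t: "0 < t"
      have "q (t *\<^sub>R v) / t \<le> q v"
      proof (rule q_ge)
        fix k c assume "(k, c) \<in> K"
        then have "(t *\<^sub>R k, t * c) \<in> K"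
          using convex_cone_scaleR[OF K, of t "(k, c)"] t by simp
        from q_le[OF this, of "t *\<^sub>R v"] sublinear_scaleR[OF p, of t "v + k"] t
        show "q (t *\<^sub>R v) / t \<le> p (v + k) - c"
          by (simp add: field_simps scaleR_add_right)
      qed
      then show "q (t *\<^sub>R v) \<le> t * q v"
        using t by (simp add: field_simps)
    qed
  qed
qed

lemma convex_cone_ray:
  "convex_cone {(t *\<^sub>R v, t * c) | t. 0 \<le> (t::real)}"
  unfolding convex_cone_iff
proof (intro conjI ballI allI impI)
  show "0 \<in> {(t *\<^sub>R v, t * c) | t. 0 \<le> t}" by (auto simp: zero_prod_def)
next
  fix a b assume "a \<in> {(t *\<^sub>R v, t * c) | t. 0 \<le> t}" "b \<in> {(t *\<^sub>R v, t * c) | t. 0 \<le> t}"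
  then obtain s t where "a = (s *\<^sub>R v, s * c)" "b = (t *\<^sub>R v, t * c)" "0 \<le> s" "0 \<le> t" by auto
  then have "a + b = ((s + t) *\<^sub>R v, (s + t) * c)" "0 \<le> s + t" by (auto simp: algebra_simps)
  then show "a + b \<in> {(t *\<^sub>R v, t * c) | t. 0 \<le> t}" by blast
next
  fix a and s :: real assume "a \<in> {(t *\<^sub>R v, t * c) | t. 0 \<le> t}" "0 \<le> s"
  then obtain t where "a = (t *\<^sub>R v, t * c)" "0 \<le> t" by auto
  then have "s *\<^sub>R a = ((s * t) *\<^sub>R v, (s * t) * c)" "0 \<le> s * t" using \<open>0 \<le> s\<close> by auto
  then show "s *\<^sub>R a \<in> {(t *\<^sub>R v, t * c) | t. 0 \<le> t}" by blast
qed

text \<open>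
  Members of \<open>C\<close> satisfy \<open>- p (- v) \<le> q v\<close>, so the infimum is finite. Subadditivity survives because
  two members of a chain can both be replaced by the smaller one.
\<close>

lemma sublinear_INF_chain:
  assumes ne: "C \<noteq> {}" and sub: "\<And>q. q \<in> C \<Longrightarrow> sublinear q \<and> (\<forall>v. q v \<le> p v)"
    and chain: "\<And>q r. q \<in> C \<Longrightarrow> r \<in> C \<Longrightarrow> (\<forall>v. q v \<le> r v) \<or> (\<forall>v. r v \<le> q v)"
  shows "sublinear (\<lambda>v. INF q\<in>C. q v)" and "\<And>q v. q \<in> C \<Longrightarrow> (INF q\<in>C. q v) \<le> q v"
proof -
  let ?m = "\<lambda>v. INF q\<in>C. q v"
  have bdd: "bdd_below ((\<lambda>q. q v) ` C)" for v
  proof (rule bdd_belowI2)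
    fix q assume "q \<in> C"
    then show "- p (- v) \<le> q v"
      using sub[of q] sublinear_ge_minus[of q v] by (smt (verit))
  qed
  show lower: "?m v \<le> q v" if "q \<in> C" for q v
    using cINF_lower[OF bdd that] by simp
  have greatest: "b \<le> ?m v" if "\<And>q. q \<in> C \<Longrightarrow> b \<le> q v" for b v
    using that by (intro cINF_greatest[OF ne]) auto
  show "sublinear ?m"
  proof (rule sublinearI)
    fix u v
    have sum: "?m (u + v) \<le> q u + r v" if "q \<in> C" "r \<in> C" for q r
      using chain[OF that]
    proof
      assume "\<forall>v. q v \<le> r v"
      then show ?thesis
        using lower[OF that(1), of "u + v"] sublinear_add[of q u v] sub[OF that(1)] by (smt (verit))
    next
      assume "\<forall>v. r v \<le> q v"
      then show ?thesis
        using lower[OF that(2), of "u + v"] sublinear_add[of r u v] sub[OF that(2)] by (smt (verit))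
    qed
    have "?m (u + v) - q u \<le> ?m v" if "q \<in> C" for q
      by (rule greatest) (use sum[OF that] in \<open>simp add: diff_le_eq add.commute\<close>)
    then have "?m (u + v) - ?m v \<le> ?m u"
      by (intro greatest) (simp add: algebra_simps)
    then show "?m (u + v) \<le> ?m u + ?m v" by simp
  next
    have "(\<lambda>q. q 0) ` C = {0}"
      using ne sub sublinear_zero by force
    then show "?m 0 = 0" by simp
  next
    fix t :: real and v assume t: "0 < t"
    have "?m (t *\<^sub>R v) / t \<le> ?m v"
    proof (rule greatest)
      fix q assume q: "q \<in> C"
      show "?m (t *\<^sub>R v) / t \<le> q v"
        using lower[OF q, of "t *\<^sub>R v"] sublinear_scaleR[of q t v] sub[OF q] t
        by (simp add: field_simps)
    qed
    then show "?m (t *\<^sub>R v) \<le> t * ?m v"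
      using t by (simp add: field_simps)
  qed
qed

text \<open>
  Zorn's lemma for the reversed pointwise order; chains have pointwise infima by
  \<open>sublinear_INF_chain\<close>.
\<close>

lemma minimal_sublinear_exists:
  fixes p :: "'a::real_vector \<Rightarrow> real"
  assumes p: "sublinear p"
  obtains q where "sublinear q" "\<And>v. q v \<le> p v"
    "\<And>r. sublinear r \<Longrightarrow> (\<And>v. r v \<le> q v) \<Longrightarrow> r = q"
proof -
  define A where "A = {q. sublinear q \<and> (\<forall>v. q v \<le> p v)}"
  define P where "P q r \<longleftrightarrow> (\<forall>v. r v \<le> q v)" for q r :: "'a \<Rightarrow> real"
  have "\<exists>m\<in>A. \<forall>r\<in>A. P m r \<longrightarrow> r = m"
  proof (rule predicate_Zorn)
    show "partial_order_on A (relation_of P A)"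
    proof (rule partial_order_on_relation_ofI)
      show "P a c" if "P a b" "P b c" for a b c
        using that unfolding P_def by (meson order_trans)
      show "a = b" if "P a b" "P b a" for a b
        using that by (intro ext antisym) (simp_all add: P_def)
    qed (simp add: P_def)
  next
    fix C assume C: "C \<in> Chains (relation_of P A)"
    have CA: "C \<subseteq> A" using C by (rule Chains_relation_of)
    show "\<exists>u\<in>A. \<forall>a\<in>C. P a u"
    proof (cases "C = {}")
      case True
      then show ?thesis using p by (auto simp: A_def)
    next
      case False
      have sub: "sublinear q \<and> (\<forall>v. q v \<le> p v)" if "q \<in> C" for q
        using CA that by (auto simp: A_def)
      have chain: "(\<forall>v. q v \<le> r v) \<or> (\<forall>v. r v \<le> q v)" if "q \<in> C" "r \<in> C" for q r
        using C that by (auto simp: Chains_def relation_of_def P_def)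
      note inf = sublinear_INF_chain[of C p, OF False sub chain]
      obtain q where "q \<in> C" using False by auto
      then have "(INF q\<in>C. q v) \<le> p v" for v
        using inf(2)[of q v] sub[of q] by (meson order_trans)
      with inf(1) have "(\<lambda>v. INF q\<in>C. q v) \<in> A"
        unfolding A_def by (intro CollectI conjI allI)
      moreover have "\<forall>a\<in>C. P a (\<lambda>v. INF q\<in>C. q v)"
        unfolding P_def by (intro ballI allI inf(2))
      ultimately show ?thesis by (intro bexI)
    qed
  qed
  then obtain q where q: "q \<in> A" "\<And>r. r \<in> A \<Longrightarrow> P q r \<Longrightarrow> r = q" by metis
  show thesis
  proof
    show "sublinear q" "\<And>v. q v \<le> p v" using q(1) by (auto simp: A_def)
    fix r assume r: "sublinear r" "\<And>v. r v \<le> q v"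
    have "r v \<le> p v" for v
      using r(2)[of v] q(1) unfolding A_def by (blast intro: order_trans)
    with r show "r = q"
      by (intro q(2)) (simp_all add: A_def P_def)
  qed
qed

text \<open>
  Improving \<open>q\<close> along the ray through \<open>(v, q v)\<close> yields a smaller sublinear functional whose value
  at \<open>- v\<close> is at most \<open>- q v\<close>. By minimality it equals \<open>q\<close>, so \<open>q\<close> is odd, and an odd sublinear
  functional is linear.
\<close>

lemma linear_if_minimal_sublinear:
  fixes q :: "'a::real_vector \<Rightarrow> real"
  assumes q: "sublinear q"
    and minimal: "\<And>r. sublinear r \<Longrightarrow> (\<And>v. r v \<le> q v) \<Longrightarrow> r = q"
  shows "linear q"
proof -
  have minus: "q (- v) = - q v" for v
  proof (rule antisym)
    have "c \<le> q w" if "(w, c) \<in> {(t *\<^sub>R v, t * q v) | t. 0 \<le> t}" for w c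
      using that sublinear_scaleR[OF q] by auto
    then obtain r where "sublinear r" "\<And>w. r w \<le> q w"
      "\<And>w c. (w, c) \<in> {(t *\<^sub>R v, t * q v) | t. 0 \<le> t} \<Longrightarrow> r (- w) \<le> - c"
      using sublinear_improve[OF q convex_cone_ray, of v "q v"] by blast
    moreover from this have "r = q" using minimal by blast
    moreover have "(v, q v) \<in> {(t *\<^sub>R v, t * q v) | t. 0 \<le> t}"
      by (auto intro!: exI[of _ 1])
    ultimately show "q (- v) \<le> - q v" by blast
    show "- q v \<le> q (- v)" using sublinear_ge_minus[OF q, of "- v"] by simp
  qed
  show ?thesis
  proof (rule linearI)
    fix u v :: 'a and t :: real
    show "q (u + v) = q u + q v"
      using sublinear_add[OF q, of u v] sublinear_add[OF q, of "- u" "- v"] minus[of u] minus[of v]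
        minus[of "u + v"] by simp
    show "q (t *\<^sub>R v) = t *\<^sub>R q v"
    proof (cases "0 \<le> t")
      case True
      then show ?thesis using sublinear_scaleR[OF q] by simp
    next
      case False
      then have "q ((- t) *\<^sub>R v) = (- t) * q v" by (intro sublinear_scaleR[OF q]) simp
      then show ?thesis using minus[of "t *\<^sub>R v"] by simp
    qed
  qed
qed

text \<open>
  The improvement of \<open>p\<close> bounds \<open>- v\<close> by \<open>- c\<close> for each constraint \<open>(v, c)\<close>; a linear functional
  below it therefore has value at least \<open>c\<close> at \<open>v\<close>.
\<close>

theorem Mazur_Orlicz:
  fixes p :: "'a::real_vector \<Rightarrow> real"
  assumes "sublinear p" "convex_cone K" "\<And>v c. (v, c) \<in> K \<Longrightarrow> c \<le> p v"
  obtains f where "linear f" "\<And>v. f v \<le> p v" "\<And>v c. (v, c) \<in> K \<Longrightarrow> c \<le> f v"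
proof -
  obtain q where q: "sublinear q" "\<And>v. q v \<le> p v" "\<And>v c. (v, c) \<in> K \<Longrightarrow> q (- v) \<le> - c"
    using sublinear_improve[OF assms] by blast
  obtain f where f: "sublinear f" "\<And>v. f v \<le> q v"
    "\<And>r. sublinear r \<Longrightarrow> (\<And>v. r v \<le> f v) \<Longrightarrow> r = f"
    using minimal_sublinear_exists[OF q(1)] by blast
  have lin: "linear f" using f(1,3) by (rule linear_if_minimal_sublinear)
  show thesis
  proof
    show "f v \<le> p v" for v using f(2) q(2) by (rule order_trans)
    show "c \<le> f v" if "(v, c) \<in> K" for v c
      using f(2)[of "- v"] q(3)[OF that] linear_neg[OF lin, of v] by simp
  qed (fact lin)
qed

corollary Mazur_Orlicz_norm:
  fixes K :: "('a::real_normed_vector \<times> real) set"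
  assumes "convex_cone K" "\<And>v c. (v, c) \<in> K \<Longrightarrow> c \<le> norm v"
  obtains f :: "'a \<Rightarrow>\<^sub>L real" where "norm f \<le> 1" "\<And>v c. (v, c) \<in> K \<Longrightarrow> c \<le> blinfun_apply f v"
proof -
  have "sublinear (norm :: 'a \<Rightarrow> real)"
    unfolding sublinear_def by (simp add: norm_triangle_ineq)
  from Mazur_Orlicz[OF this assms] obtain f :: "'a \<Rightarrow> real"
    where f: "linear f" "\<And>v. f v \<le> norm v" "\<And>v c. (v, c) \<in> K \<Longrightarrow> c \<le> f v"
    by blast
  have bound: "norm (f v) \<le> 1 * norm v" for v
    using f(2)[of v] f(2)[of "- v"] linear_neg[OF f(1), of v] by simp
  have "bounded_linear f"
    using bound by (intro bounded_linear_intro[of f 1])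
      (auto simp: linear_add[OF f(1)] linear_scale[OF f(1)])
  then have app: "blinfun_apply (Blinfun f) = f" by (rule bounded_linear_Blinfun_apply)
  show thesis
  proof
    show "norm (Blinfun f) \<le> 1"
      using bound by (intro norm_blinfun_bound) (simp_all add: app)
    show "\<And>v c. (v, c) \<in> K \<Longrightarrow> c \<le> blinfun_apply (Blinfun f) v" using f(3) by (simp add: app)
  qed
qed

lemma blinfun_apply_le_norm:
  fixes f :: "'a::real_normed_vector \<Rightarrow>\<^sub>L real"
  assumes "norm f \<le> 1"
  shows "\<bar>f v\<bar> \<le> norm v"
  using norm_blinfun[of f v] mult_right_mono[OF assms, of "norm v"] by simp

lemma norming_functional:
  fixes v :: "'a::real_normed_vector"
  obtains f :: "'a \<Rightarrow>\<^sub>L real" where "norm f \<le> 1" "f v = norm v"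
proof -
  obtain f :: "'a \<Rightarrow>\<^sub>L real" where f: "norm f \<le> 1"
    "\<And>w c. (w, c) \<in> {(t *\<^sub>R v, t * norm v) | t. 0 \<le> t} \<Longrightarrow> c \<le> f w"
  proof (rule Mazur_Orlicz_norm[OF convex_cone_ray, of v "norm v"])
    show "c \<le> norm w" if "(w, c) \<in> {(t *\<^sub>R v, t * norm v) | t. 0 \<le> t}" for w c
      using that by auto
  qed (use that in blast)
  have "norm v \<le> f v"
    by (rule f(2)) (auto intro!: exI[of _ 1])
  with f(1) show thesis
    using blinfun_apply_le_norm[OF f(1), of v] by (intro that) auto
qed

section \<open>Thinning out a weakly null sequence\<close>

text \<open>
  A form of the Banach--Alaoglu theorem. Let \<open>G N\<close> be the set of functionals satisfying the first
  \<open>N\<close> constraints. The cone consists of the lower bounds \<open>(v, c)\<close> that hold on some \<open>G N\<close>. It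
  contains all the given constraints, and \<open>c \<le> norm v\<close> holds on it because no \<open>G N\<close> is empty.
\<close>

lemma dual_ball_compactness:
  fixes y :: "nat \<Rightarrow> 'a::real_normed_vector" and \<epsilon> :: real
  assumes "\<And>N. \<exists>g :: 'a \<Rightarrow>\<^sub>L real. norm g \<le> 1 \<and> (\<forall>i\<in>I. i < N \<longrightarrow> \<epsilon> \<le> blinfun_apply g (y i))"
  obtains f :: "'a \<Rightarrow>\<^sub>L real" where "norm f \<le> 1" "\<And>i. i \<in> I \<Longrightarrow> \<epsilon> \<le> blinfun_apply f (y i)"
proof -
  define G :: "nat \<Rightarrow> ('a \<Rightarrow>\<^sub>L real) set"
    where "G N = {g. norm g \<le> 1 \<and> (\<forall>i\<in>I. i < N \<longrightarrow> \<epsilon> \<le> blinfun_apply g (y i))}" for N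
  have ne: "\<exists>g. g \<in> G N" for N using assms[of N] by (auto simp: G_def)
  have anti: "G N \<subseteq> G M" if "M \<le> N" for M N using that by (auto simp: G_def)
  define K where "K = {(v, c). \<exists>N. \<forall>g\<in>G N. c \<le> blinfun_apply g v}"
  have K: "(v, c) \<in> K \<longleftrightarrow> (\<exists>N. \<forall>g\<in>G N. c \<le> blinfun_apply g v)" for v c
    by (simp add: K_def)
  have "convex_cone K"
    unfolding convex_cone_iff
  proof (intro conjI ballI allI impI)
    show "0 \<in> K" by (simp add: K zero_prod_def)
  next
    fix a b assume ab: "a \<in> K" "b \<in> K"
    obtain v c w e where eq: "a = (v, c)" "b = (w, e)" by (cases a, cases b)
    obtain M N where M: "\<forall>g\<in>G M. c \<le> blinfun_apply g v" and N: "\<forall>g\<in>G N. e \<le> blinfun_apply g w"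
      using ab unfolding eq K by auto
    have "c + e \<le> blinfun_apply g (v + w)" if "g \<in> G (max M N)" for g
    proof -
      have "g \<in> G M" "g \<in> G N" using anti[of M "max M N"] anti[of N "max M N"] that by auto
      with M N have "c \<le> blinfun_apply g v" "e \<le> blinfun_apply g w" by blast+
      then show ?thesis by (simp add: blinfun.add_right)
    qed
    then show "a + b \<in> K" unfolding eq add_Pair K by blast
  next
    fix a and s :: real assume as: "a \<in> K" "0 \<le> s"
    obtain v c where eq: "a = (v, c)" by (cases a)
    obtain N where N: "\<forall>g\<in>G N. c \<le> blinfun_apply g v"
      using as(1) unfolding eq K by auto
    then have "\<forall>g\<in>G N. s * c \<le> blinfun_apply g (s *\<^sub>R v)"
      using \<open>0 \<le> s\<close> by (simp add: blinfun.scaleR_right mult_left_mono)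
    then show "s *\<^sub>R a \<in> K" unfolding eq scaleR_Pair real_scaleR_def K by blast
  qed
  moreover have "c \<le> norm v" if vc: "(v, c) \<in> K" for v c
  proof -
    obtain N where N: "\<forall>g\<in>G N. c \<le> blinfun_apply g v" using vc[unfolded K] by blast
    obtain g where g: "g \<in> G N" using ne by blast
    then have "\<bar>blinfun_apply g v\<bar> \<le> norm v" by (intro blinfun_apply_le_norm) (simp add: G_def)
    moreover have "c \<le> blinfun_apply g v" using N g by blast
    ultimately show ?thesis by linarith
  qed
  ultimately obtain f :: "'a \<Rightarrow>\<^sub>L real"
    where f: "norm f \<le> 1" "\<And>v c. (v, c) \<in> K \<Longrightarrow> c \<le> f v"
    using Mazur_Orlicz_norm[of K] by blast
  have "(y i, \<epsilon>) \<in> K" if "i \<in> I" for i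
  proof -
    have "\<forall>g\<in>G (Suc i). \<epsilon> \<le> blinfun_apply g (y i)" using that by (simp add: G_def)
    then show ?thesis unfolding K by blast
  qed
  with f show thesis using that by blast
qed

lemma weakly_null_not_uniformly_large:
  fixes x :: "nat \<Rightarrow> 'a::real_normed_vector" and \<epsilon> :: real
  assumes "weakly_null x" "infinite I" "\<epsilon> > 0"
  obtains N where "\<And>g :: 'a \<Rightarrow>\<^sub>L real. norm g \<le> 1 \<Longrightarrow> \<exists>i\<in>I. i < N \<and> blinfun_apply g (x i) < \<epsilon>"
proof -
  have False if large: "\<And>N. \<exists>g :: 'a \<Rightarrow>\<^sub>L real. norm g \<le> 1 \<and> (\<forall>i\<in>I. i < N \<longrightarrow> \<epsilon> \<le> blinfun_apply g (x i))"
  proof -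
    obtain f :: "'a \<Rightarrow>\<^sub>L real" where f: "\<And>i. i \<in> I \<Longrightarrow> \<epsilon> \<le> f (x i)"
      using dual_ball_compactness[OF large] by blast
    have "(\<lambda>n. f (x n)) \<longlonglongrightarrow> 0" using assms(1) by (simp add: weakly_null_def)
    then have "\<forall>\<^sub>F n in sequentially. f (x n) < \<epsilon>"
      using \<open>\<epsilon> > 0\<close> by (rule order_tendstoD)
    then obtain N where N: "\<And>n. N \<le> n \<Longrightarrow> f (x n) < \<epsilon>"
      by (auto simp: eventually_sequentially)
    obtain n where "n \<in> I" "N \<le> n"
      using \<open>infinite I\<close> by (metis infinite_nat_iff_unbounded_le)
    with f N show False by fastforce
  qed
  then show thesis using that by (meson not_le)
qed

definition triple_free :: "(nat \<Rightarrow> nat \<Rightarrow> nat \<Rightarrow> bool) \<Rightarrow> nat set \<Rightarrow> bool" where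
  "triple_free P M \<longleftrightarrow> (\<forall>p\<in>M. \<forall>q\<in>M. \<forall>r\<in>M. p < q \<longrightarrow> q < r \<longrightarrow> \<not> P p q r)"

text \<open>
  By Ramsey's theorem these sets of triples form an ideal, and each of them can be
  avoided on some infinite subset of any given infinite set.
\<close>

definition negligible_triples :: "(nat \<Rightarrow> nat \<Rightarrow> nat \<Rightarrow> bool) \<Rightarrow> bool" where
  "negligible_triples P \<longleftrightarrow> (\<forall>M. infinite M \<longrightarrow> \<not> triple_free (\<lambda>p q r. \<not> P p q r) M)"

lemma Ramsey_triples:
  assumes "infinite Z"
  obtains M where "M \<subseteq> Z" "infinite M" "triple_free P M \<or> triple_free (\<lambda>p q r. \<not> P p q r) M"
proof -
  define f :: "nat set \<Rightarrow> nat"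
    where "f X = (if \<exists>p q r. p < q \<and> q < r \<and> X = {p, q, r} \<and> P p q r then 1 else 0)" for X
  have "\<forall>X. X \<subseteq> Z \<and> finite X \<and> card X = 3 \<longrightarrow> f X < 2" by (simp add: f_def)
  from Ramsey[OF assms this] obtain M t where M: "M \<subseteq> Z" "infinite M"
    and mono: "\<forall>X. X \<subseteq> M \<and> finite X \<and> card X = 3 \<longrightarrow> f X = t"
    by (elim exE conjE)
  have f: "f {p, q, r} = (if P p q r then 1 else 0)" if "p < q" "q < r" for p q r
  proof -
    have "a = p \<and> b = q \<and> c = r" if abc: "{p, q, r} = {a, b, c}" "a < b" "b < c" for a b c
    proof -
      have "sorted_list_of_set {p, q, r} = sorted_list_of_set {a, b, c}" using abc(1) by simp
      then show ?thesis using \<open>p < q\<close> \<open>q < r\<close> abc(2,3) by simp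
    qed
    with that show ?thesis unfolding f_def by metis
  qed
  have t: "f {p, q, r} = t" if "p \<in> M" "q \<in> M" "r \<in> M" "p < q" "q < r" for p q r
    using that by (intro mono[rule_format]) auto
  have "triple_free P M \<or> triple_free (\<lambda>p q r. \<not> P p q r) M"
  proof (cases "t = 1")
    case True
    then show ?thesis using t f unfolding triple_free_def by (metis zero_neq_one)
  next
    case False
    then show ?thesis using t f unfolding triple_free_def by metis
  qed
  with M show thesis by (rule that)
qed

lemma triple_free_mono: "triple_free P M \<Longrightarrow> N \<subseteq> M \<Longrightarrow> triple_free P N"
  by (auto simp: triple_free_def)

lemma negligible_triples_avoid:
  assumes "negligible_triples P" "infinite Z"
  obtains M where "M \<subseteq> Z" "infinite M" "triple_free P M"
  using Ramsey_triples[OF assms(2), of P] assms(1) by (metis negligible_triples_def)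

lemma negligible_triples_disj:
  assumes "negligible_triples P" "negligible_triples Q"
  shows "negligible_triples (\<lambda>p q r. P p q r \<or> Q p q r)"
  unfolding negligible_triples_def
proof (intro allI impI notI)
  fix Z assume Z: "infinite Z" and PQ: "triple_free (\<lambda>p q r. \<not> (P p q r \<or> Q p q r)) Z"
  obtain M where M: "M \<subseteq> Z" "infinite M" "triple_free P M"
    using negligible_triples_avoid[OF assms(1) Z] .
  have "triple_free (\<lambda>p q r. \<not> Q p q r) M"
    using triple_free_mono[OF PQ M(1)] M(3) by (auto simp: triple_free_def)
  with M(2) assms(2) show False by (auto simp: negligible_triples_def)
qed

text \<open>
  The three relative positions of the evaluation point and the two indices of the functional. If all
  triples in \<open>M\<close> were bad, a suitable choice of the indices would give a functional that is large on a
  long piece of \<open>M\<close>: on its elements below \<open>q\<close>, between \<open>p\<close> and \<open>r\<close>, or above \<open>q\<close>.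
\<close>

lemma weakly_null_negligible_triples:
  fixes x :: "nat \<Rightarrow> 'a::real_normed_vector" and \<epsilon> :: real
    and F :: "nat \<Rightarrow> nat \<Rightarrow> 'a \<Rightarrow>\<^sub>L real"
  assumes x: "weakly_null x" and \<epsilon>: "\<epsilon> > 0" and F: "\<And>i j. norm (F i j) \<le> 1"
  shows "negligible_triples (\<lambda>p q r. \<epsilon> \<le> F q r (x p))" (is ?before)
    and "negligible_triples (\<lambda>p q r. \<epsilon> \<le> F p r (x q))" (is ?between)
    and "negligible_triples (\<lambda>p q r. \<epsilon> \<le> F p q (x r))" (is ?after)
proof -
  have above: "\<exists>p\<in>M. n \<le> p" if "infinite M" for M and n :: nat
    using that by (metis infinite_nat_iff_unbounded_le)
  have tail: "infinite {i\<in>M. n < i}" if "infinite M" for M and n :: nat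
  proof -
    have "{i\<in>M. n < i} = M - {..n}" by auto
    then show ?thesis using that by (simp add: Diff_infinite_finite)
  qed
  show ?before
    unfolding negligible_triples_def
  proof (intro allI impI notI)
    fix M assume M: "infinite M" and bad: "triple_free (\<lambda>p q r. \<not> \<epsilon> \<le> F q r (x p)) M"
    obtain N where N: "\<And>g :: 'a \<Rightarrow>\<^sub>L real. norm g \<le> 1 \<Longrightarrow> \<exists>i\<in>M. i < N \<and> blinfun_apply g (x i) < \<epsilon>"
      using weakly_null_not_uniformly_large[OF x M \<epsilon>] by blast
    obtain q where q: "q \<in> M" "N \<le> q" using above[OF M] by blast
    obtain r where r: "r \<in> M" "Suc q \<le> r" using above[OF M] by blast
    obtain p where "p \<in> M" "p < N" "F q r (x p) < \<epsilon>" using N[OF F] by blast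
    with q r bad show False by (fastforce simp: triple_free_def)
  qed
  show ?between
    unfolding negligible_triples_def
  proof (intro allI impI notI)
    fix M assume M: "infinite M" and bad: "triple_free (\<lambda>p q r. \<not> \<epsilon> \<le> F p r (x q)) M"
    obtain p where p: "p \<in> M" using above[OF M] by blast
    obtain N where N: "\<And>g :: 'a \<Rightarrow>\<^sub>L real. norm g \<le> 1 \<Longrightarrow> \<exists>i\<in>{i\<in>M. p < i}. i < N \<and> blinfun_apply g (x i) < \<epsilon>"
      using weakly_null_not_uniformly_large[OF x tail[OF M] \<epsilon>] by blast
    obtain r where r: "r \<in> M" "N \<le> r" using above[OF M] by blast
    obtain q where "q \<in> M" "p < q" "q < N" "F p r (x q) < \<epsilon>" using N[OF F] by blast
    with p r bad show False by (fastforce simp: triple_free_def)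
  qed
  show ?after
    unfolding negligible_triples_def
  proof (intro allI impI notI)
    fix M assume M: "infinite M" and bad: "triple_free (\<lambda>p q r. \<not> \<epsilon> \<le> F p q (x r)) M"
    obtain p where p: "p \<in> M" using above[OF M] by blast
    obtain q where q: "q \<in> M" "Suc p \<le> q" using above[OF M] by blast
    obtain N where N: "\<And>g :: 'a \<Rightarrow>\<^sub>L real. norm g \<le> 1 \<Longrightarrow> \<exists>i\<in>{i\<in>M. q < i}. i < N \<and> blinfun_apply g (x i) < \<epsilon>"
      using weakly_null_not_uniformly_large[OF x tail[OF M] \<epsilon>] by blast
    obtain r where "r \<in> M" "q < r" "F p q (x r) < \<epsilon>" using N[OF F] by blast
    with p q bad show False by (fastforce simp: triple_free_def)
  qed
qed

text \<open>
  Three positions and two signs give six negligible sets of triples, which are avoided simultaneously.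
\<close>

lemma weakly_null_thinning:
  fixes x :: "nat \<Rightarrow> 'a::real_normed_vector" and \<epsilon> :: real
    and F :: "nat \<Rightarrow> nat \<Rightarrow> 'a \<Rightarrow>\<^sub>L real"
  assumes x: "weakly_null x" and \<epsilon>: "\<epsilon> > 0" and F: "\<And>i j. norm (F i j) \<le> 1"
    and Z: "infinite Z"
  obtains M where "M \<subseteq> Z" "infinite M"
    "\<And>i j k. \<lbrakk>i \<in> M; j \<in> M; k \<in> M; i < j; k \<noteq> i; k \<noteq> j\<rbrakk> \<Longrightarrow> \<bar>F i j (x k)\<bar> < \<epsilon>"
proof -
  have F': "norm (- F i j) \<le> 1" for i j using F by simp
  note neg = weakly_null_negligible_triples[OF x \<epsilon>, of F, OF F]
    weakly_null_negligible_triples[OF x \<epsilon>, of "\<lambda>i j. - F i j", OF F']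
  note bad = neg(1)[THEN negligible_triples_disj, OF neg(2)[THEN negligible_triples_disj,
      OF neg(3)[THEN negligible_triples_disj, OF neg(4)[THEN negligible_triples_disj,
      OF neg(5)[THEN negligible_triples_disj, OF neg(6)]]]]]
  obtain M where M: "M \<subseteq> Z" "infinite M"
    and free: "triple_free (\<lambda>p q r. \<epsilon> \<le> F q r (x p) \<or> \<epsilon> \<le> F p r (x q) \<or> \<epsilon> \<le> F p q (x r) \<or>
      \<epsilon> \<le> (- F q r) (x p) \<or> \<epsilon> \<le> (- F p r) (x q) \<or> \<epsilon> \<le> (- F p q) (x r)) M"
    using negligible_triples_avoid[OF bad Z] by blast
  have "\<bar>F i j (x k)\<bar> < \<epsilon>"
    if "i \<in> M" "j \<in> M" "k \<in> M" "i < j" "k \<noteq> i" "k \<noteq> j" for i j k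
  proof -
    have "k < i \<or> i < k \<and> k < j \<or> j < k" using that by linarith
    then show ?thesis
      using free that(1-4) unfolding triple_free_def
      by (elim disjE) (force simp: blinfun.minus_left)+
  qed
  with M show thesis by (rule that)
qed

section \<open>The lower bound\<close>

text \<open>
  After thinning for both families \<open>g\<close> and \<open>h\<close>, the functional \<open>h\<^sub>i\<^sub>j + 3\<eta> (g\<^sub>j - g\<^sub>i)\<close> has norm at most
  \<open>1 + 6\<eta>\<close>, takes its least value at \<open>x\<^sub>i\<close> and its greatest at \<open>x\<^sub>j\<close>.
\<close>

lemma antipodal_subsequence:
  fixes x :: "nat \<Rightarrow> 'a::real_normed_vector"
  assumes norm1: "\<And>n. norm (x n) = 1" and x: "weakly_null x"
    and sep: "\<And>n m. n \<noteq> m \<Longrightarrow> norm (x n - x m) \<ge> d"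
    and \<delta>: "0 < \<delta>" "\<delta> < d"
  obtains M where "infinite M" "bsa 1 1 \<delta> (x ` M)"
proof -
  \<comment> \<open>The bound \<open>1/9\<close> makes \<open>3\<eta>\<^sup>2 \<le> \<eta>/3\<close>, so that the cross terms of the correction are harmless; the
    second bound lets the normalized functional still separate by \<open>\<delta>\<close>.\<close>
  define \<eta> where "\<eta> = min (1/9) ((d - \<delta>) / (1 + 6 * \<delta>))"
  have \<eta>: "0 < \<eta>" "\<eta> \<le> 1/9" unfolding \<eta>_def using \<delta> by (simp, intro min.cobounded1)
  have "\<eta> \<le> (d - \<delta>) / (1 + 6 * \<delta>)" by (simp add: \<eta>_def)
  then have \<eta>\<delta>: "\<delta> * (1 + 6 * \<eta>) \<le> d - \<eta>" using \<delta> by (simp add: field_simps)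
  have "\<exists>f :: 'a \<Rightarrow>\<^sub>L real. norm f \<le> 1 \<and> blinfun_apply f v = norm v" for v
    using norming_functional[of v] by blast
  then obtain N :: "'a \<Rightarrow> 'a \<Rightarrow>\<^sub>L real" where N: "\<And>v. norm (N v) \<le> 1" "\<And>v. blinfun_apply (N v) v = norm v"
    by metis
  define g where "g i = N (x i)" for i
  define h where "h i j = (if d \<le> 1 then g j else N (x j - x i))" for i j
  have g: "norm (g i) \<le> 1" "g i (x i) = 1" for i
    using N[of "x i"] norm1 by (auto simp: g_def)
  have h: "norm (h i j) \<le> 1" for i j using N(1) by (simp add: h_def g_def)
  \<comment> \<open>The second index is a dummy here; any larger element of \<open>M1\<close> can play it, see \<open>gk\<close>.\<close>
  obtain M1 where M1: "infinite M1"
    "\<And>i j k. \<lbrakk>i \<in> M1; j \<in> M1; k \<in> M1; i < j; k \<noteq> i; k \<noteq> j\<rbrakk> \<Longrightarrow> \<bar>g i (x k)\<bar> < \<eta>"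
    using weakly_null_thinning[where F = "\<lambda>i j. g i", OF x \<eta>(1) g(1) infinite_UNIV_nat]
    by metis
  obtain M where M: "M \<subseteq> M1" "infinite M"
    "\<And>i j k. \<lbrakk>i \<in> M; j \<in> M; k \<in> M; i < j; k \<noteq> i; k \<noteq> j\<rbrakk> \<Longrightarrow> \<bar>h i j (x k)\<bar> < \<eta>"
    using weakly_null_thinning[where F = h, OF x \<eta>(1) h M1(1)] by metis
  have gk: "\<bar>g i (x k)\<bar> < \<eta>" if "i \<in> M" "k \<in> M" "k \<noteq> i" for i k
  proof -
    obtain j where "j \<in> M1" "max i k < j"
      using M1(1) by (metis infinite_nat_iff_unbounded)
    then show ?thesis using M1(2)[of i j k] that M(1) by auto
  qed
  have hij: "h i j (x i) \<le> \<eta>" "0 \<le> h i j (x j)" "d - \<eta> \<le> h i j (x j) - h i j (x i)"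
    if "i \<in> M" "j \<in> M" "i < j" for i j
  proof -
    have "h i j (x i) \<le> \<eta> \<and> 0 \<le> h i j (x j) \<and> d - \<eta> \<le> h i j (x j) - h i j (x i)"
    proof (cases "d \<le> 1")
      case True
      then show ?thesis using gk[of j i] g(2)[of j] that by (auto simp: h_def)
    next
      case False
      have "h i j (x j - x i) = norm (x j - x i)" using False N(2) by (simp add: h_def)
      then have "d \<le> h i j (x j) - h i j (x i)"
        using sep[of j i] that by (simp add: blinfun.diff_right)
      moreover have "\<bar>h i j (x j)\<bar> \<le> 1" "\<bar>h i j (x i)\<bar> \<le> 1"
        using blinfun_apply_le_norm[OF h] norm1 by metis+
      ultimately show ?thesis using False \<eta>(1) by linarith
    qed
    then show "h i j (x i) \<le> \<eta>" "0 \<le> h i j (x j)" "d - \<eta> \<le> h i j (x j) - h i j (x i)" by auto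
  qed
  have sep_func: "\<exists>f :: 'a \<Rightarrow>\<^sub>L real. norm f \<le> 1 \<and>
      \<delta> \<le> blinfun_apply f (x j) - blinfun_apply f (x i) \<and>
      (\<forall>k\<in>M. blinfun_apply f (x i) \<le> blinfun_apply f (x k) \<and>
        blinfun_apply f (x k) \<le> blinfun_apply f (x j))"
    if ij: "i \<in> M" "j \<in> M" "i < j" for i j
  proof -
    define c where "c = inverse (1 + 6 * \<eta>)"
    have c: "0 < c" using \<eta>(1) by (simp add: c_def)
    define H where "H = h i j - (3 * \<eta>) *\<^sub>R g i + (3 * \<eta>) *\<^sub>R g j"
    have H: "H v = h i j v - 3 * \<eta> * g i v + 3 * \<eta> * g j v" for v
      by (simp add: H_def blinfun.add_left blinfun.diff_left blinfun.scaleR_left)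
    have "norm H \<le> norm (h i j) + norm ((3 * \<eta>) *\<^sub>R g i) + norm ((3 * \<eta>) *\<^sub>R g j)"
      unfolding H_def by (intro norm_triangle_le add_mono norm_triangle_ineq4 order_refl)
    also have "\<dots> = norm (h i j) + 3 * \<eta> * norm (g i) + 3 * \<eta> * norm (g j)"
      using \<eta>(1) by simp
    also have "\<dots> \<le> 1 + 3 * \<eta> * 1 + 3 * \<eta> * 1"
      using \<eta>(1) h g(1) by (intro add_mono mult_left_mono) auto
    finally have "norm H \<le> 1 + 6 * \<eta>" by simp
    then have norm: "norm (c *\<^sub>R H) \<le> 1"
      using \<eta>(1) by (simp add: c_def field_simps)
    have small: "\<bar>3 * \<eta> * a\<bar> \<le> \<eta> / 3" if "\<bar>a\<bar> < \<eta>" for a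
    proof -
      have "\<bar>3 * \<eta> * a\<bar> = 3 * \<eta> * \<bar>a\<bar>" using \<eta>(1) by (simp add: abs_mult)
      also have "\<dots> \<le> 3 * \<eta> * (1 / 9)" using \<eta> that by (intro mult_left_mono) auto
      finally show ?thesis by simp
    qed
    have Hi: "H (x i) \<le> h i j (x i) - 3 * \<eta> + \<eta> / 3"
      and Hj: "h i j (x j) + 3 * \<eta> - \<eta> / 3 \<le> H (x j)"
      using small[OF gk[of j i]] small[OF gk[of i j]] ij g(2) by (auto simp: H)
    have Hk: "\<bar>H (x k)\<bar> \<le> \<eta> + \<eta> / 3 + \<eta> / 3" if "k \<in> M" "k \<noteq> i" "k \<noteq> j" for k
    proof -
      have "\<bar>3 * \<eta> * g j (x k)\<bar> \<le> \<eta> / 3" "\<bar>3 * \<eta> * g i (x k)\<bar> \<le> \<eta> / 3"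
        using ij that by (intro small gk; simp)+
      moreover have "\<bar>h i j (x k)\<bar> < \<eta>"
        using ij that by (intro M(3))
      ultimately show ?thesis unfolding H by linarith
    qed
    have diff: "d - \<eta> \<le> H (x j) - H (x i)"
      using Hi Hj hij[OF ij] \<eta>(1) by linarith
    have order: "H (x i) \<le> H (x k) \<and> H (x k) \<le> H (x j)" if "k \<in> M" for k
    proof -
      consider "k = i" | "k = j" | "k \<noteq> i" "k \<noteq> j" by blast
      then show ?thesis
      proof cases
        case 3
        show ?thesis using Hk[OF that 3] Hi Hj hij[OF ij] \<eta>(1) by linarith
      qed (use Hi Hj hij[OF ij] \<eta>(1) in auto)
    qed
    have "\<delta> \<le> c * (H (x j) - H (x i))"
      using \<eta>\<delta> diff \<eta>(1) by (simp add: c_def field_simps)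
    then have "\<delta> \<le> (c *\<^sub>R H) (x j) - (c *\<^sub>R H) (x i)"
      by (simp add: blinfun.scaleR_left right_diff_distrib)
    moreover have "\<forall>k\<in>M. (c *\<^sub>R H) (x i) \<le> (c *\<^sub>R H) (x k) \<and> (c *\<^sub>R H) (x k) \<le> (c *\<^sub>R H) (x j)"
      using order c by (simp add: blinfun.scaleR_left)
    ultimately show ?thesis using norm by blast
  qed
  have "bsa 1 1 \<delta> (x ` M)"
    unfolding bsa_def
  proof (intro conjI ballI impI)
    show "norm u \<le> 1" if "u \<in> x ` M" for u using that norm1 by auto
  next
    fix u v assume "u \<in> x ` M" "v \<in> x ` M" "u \<noteq> v"
    then obtain i j where ij: "i \<in> M" "j \<in> M" "i \<noteq> j" "u = x i" "v = x j" by blast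
    show "\<exists>f :: 'a \<Rightarrow>\<^sub>L real. norm f \<le> 1 \<and>
      \<delta> \<le> blinfun_apply f v - blinfun_apply f u \<and>
      (\<forall>z\<in>x ` M. blinfun_apply f u \<le> blinfun_apply f z \<and> blinfun_apply f z \<le> blinfun_apply f v)"
    proof (cases "i < j")
      case True
      then show ?thesis using sep_func[of i j] ij by auto
    next
      case False
      then obtain f :: "'a \<Rightarrow>\<^sub>L real" where "norm f \<le> 1" 
        "\<delta> \<le> blinfun_apply f (x i) - blinfun_apply f (x j)"
        "\<forall>k\<in>M. blinfun_apply f (x j) \<le> blinfun_apply f (x k) \<and>
          blinfun_apply f (x k) \<le> blinfun_apply f (x i)"
        using sep_func[of j i] ij by (metis nat_neq_iff)
      then show ?thesis using ij by (intro exI[of _ "- f"]) (auto simp: blinfun.minus_left)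
    qed
  qed
  with M(2) show thesis by (rule that)
qed

lemma bsa_le_2:
  fixes S :: "'a::real_normed_vector set"
  assumes "bsa 1 1 \<delta> S" "infinite S"
  shows "\<delta> \<le> 2"
proof -
  obtain u where u: "u \<in> S" using assms(2) by (metis finite.emptyI equals0I)
  then obtain v where v: "v \<in> S" "u \<noteq> v"
    using assms(2) by (metis finite.emptyI finite.insertI insertCI rev_finite_subset subsetI)
  from assms(1) u v obtain f :: "'a \<Rightarrow>\<^sub>L real" where f: "norm f \<le> 1" "\<delta> \<le> f v - f u"
    unfolding bsa_def by blast
  have "norm u \<le> 1" "norm v \<le> 1" using assms(1) u v(1) by (auto simp: bsa_def)
  then show ?thesis
    using f(2) blinfun_apply_le_norm[OF f(1), of u] blinfun_apply_le_norm[OF f(1), of v] by linarith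
qed

theorem theorem1p7:
  fixes x :: "nat \<Rightarrow> 'a::banach" and d :: real
  assumes "infinite_dimensional TYPE('a)"
    and "d > 0"
    and "\<And>n. norm (x n) = 1"
    and "weakly_null x"
    and "\<And>n m. n \<noteq> m \<Longrightarrow> norm (x n - x m) \<ge> d"
  shows "K_a TYPE('a) \<ge> d"
proof -
  let ?D = "{\<delta>. \<delta> > 0 \<and> (\<exists>S::'a set. infinite S \<and> S \<subseteq> cball 0 1 \<and> bsa 1 1 \<delta> S)}"
  have "inj x"
  proof (rule injI)
    fix n m assume "x n = x m"
    then show "n = m" using assms(5)[of n m] assms(2) by auto
  qed
  have bdd: "bdd_above ?D"
    using bsa_le_2 by (intro bdd_aboveI[of _ 2]) blast
  have le: "\<delta> \<le> K_a TYPE('a)" if \<delta>: "0 < \<delta>" "\<delta> < d" for \<delta>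
  proof -
    obtain M where M: "infinite M" "bsa 1 1 \<delta> (x ` M)"
      using antipodal_subsequence[OF assms(3-5) \<delta>] by blast
    have "infinite (x ` M)"
      using M(1) \<open>inj x\<close> by (meson finite_imageD inj_on_subset subset_UNIV)
    moreover have "x ` M \<subseteq> cball 0 1" using assms(3) by auto
    ultimately have "\<delta> \<in> ?D" using M(2) \<delta>(1) by blast
    then show ?thesis
      unfolding K_a_def using bdd by (rule cSup_upper)
  qed
  show ?thesis
    by (rule dense_le_bounded[OF assms(2) le])
qed

end
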